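(* Let $n\ge2$ and let $\pi:S_n\to S_{n-1}$ be the deletion map erasing the letter $n$. Identify the vertices of $R(\pi)$ (equivalently of $\widehat R(\pi)$) with subsets of $[n-1]$. Then the augmented Reeb poset $\widehat{\mathsf{Reeb}}(\pi)$ is the total order on $\mathcal P([n-1])$ induced by $\nu(A):=\sum_{i\in A}2^{i-1}$: $$A\le_{\widehat{\mathsf{Reeb}}(\pi)}B\iff \nu(A)\le\nu(B).$$
   Context: $[m]=\{1,\dots,m\}$ and $\mathcal P$ denotes the power set. $S_n$ is the set of permutations written as words on $\{1,\dots,n\}$, with the (right) weak order: the poset whose cover relations $u\to v$ are the swaps of adjacent letters $\cdots a\,b\cdots\mapsto\cdots b\,a\cdots$ with $a<b$. The map $\pi:S_n\to S_{n-1}$ deletes the letter $n$ from the word. For every cover $v\to w$ in $S_n$, either $\pi(v)=\pi(w)$ (vertical cover) or $\pi(v)\to\pi(w)$ is a cover in $S_{n-1}$ (horizontal cover). Let $\sim_h$ be the equivalence relation on $S_n$ generated by $v\sim_h w$ for horizontal covers $v\to w$; $[v]$ denotes the class of $v$. The pre-Reeb graph $R(\pi)$ is the directed graph whose vertices are the $\sim_h$-classes, with an edge $[v]\to[w]$ whenever there are $v'\in[v]$, $w'\in[w]$ such that $v'\to w'$ is a vertical cover. Its vertex set is identified with $\mathcal P([n-1])$ by the bijection $[w]\mapsto A(w):=\{i\in[n-1]\mid n\text{ occurs to the left of }i\text{ in }w\}$. The augmented pre-Reeb graph $\widehat R(\pi)$ is obtained from $R(\pi)$ by adding an auxiliary edge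 $[v]\to[w]$ whenever there are $v'\in[v]$, $w'\in[w]$ such that $\pi(w')<\pi(v')$ in $S_{n-1}$ and $v',w'$ are incomparable in $S_n$. In the present setting $\widehat R(\pi)$ is acyclic, and the augmented Reeb poset $\widehat{\mathsf{Reeb}}(\pi)$ is its reachability poset: $x\le_{\widehat{\mathsf{Reeb}}(\pi)}y$ iff there is a directed path (possibly of length 0) from $x$ to $y$ in $\widehat R(\pi)$. *)

theory Defs
  imports "HOL-Combinatorics.Multiset_Permutations"
begin

abbreviation S :: "nat \<Rightarrow> nat list set" where
  "S n \<equiv> permutations_of_set {1..n}"

definition weak_cover :: "nat \<Rightarrow> (nat list \<times> nat list) set" where
  "weak_cover n = {(u, v). u \<in> S n \<and> v \<in> S n \<and>
     (\<exists>xs a b ys. a < b \<and> u = xs @ [a, b] @ ys \<and> v = xs @ [b, a] @ ys)}"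

definition weak_le :: "nat \<Rightarrow> nat list \<Rightarrow> nat list \<Rightarrow> bool" where
  "weak_le n u v \<longleftrightarrow> u \<in> S n \<and> v \<in> S n \<and> (u, v) \<in> (weak_cover n)\<^sup>*"

definition weak_less :: "nat \<Rightarrow> nat list \<Rightarrow> nat list \<Rightarrow> bool" where
  "weak_less n u v \<longleftrightarrow> weak_le n u v \<and> u \<noteq> v"

definition deletion :: "nat \<Rightarrow> nat list \<Rightarrow> nat list" where
  "deletion n w = removeAll n w"

definition vertical_cover :: "nat \<Rightarrow> (nat list \<times> nat list) set" where
  "vertical_cover n = {(v, w) \<in> weak_cover n. deletion n v = deletion n w}"

definition horizontal_cover :: "nat \<Rightarrow> (nat list \<times> nat list) set" where
  "horizontal_cover n =
     {(v, w) \<in> weak_cover n. (deletion n v, deletion n w) \<in> weak_cover (n - 1)}"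

definition sim_h :: "nat \<Rightarrow> (nat list \<times> nat list) set" where
  "sim_h n = (horizontal_cover n \<union> (horizontal_cover n)\<inverse>)\<^sup>* \<inter> S n \<times> S n"

definition reeb_vertices :: "nat \<Rightarrow> nat list set set" where
  "reeb_vertices n = S n // sim_h n"

definition reeb_edges :: "nat \<Rightarrow> (nat list set \<times> nat list set) set" where
  "reeb_edges n = {(X, Y). X \<in> reeb_vertices n \<and> Y \<in> reeb_vertices n \<and>
     (\<exists>v\<in>X. \<exists>w\<in>Y. (v, w) \<in> vertical_cover n)}"

definition auxiliary_edges :: "nat \<Rightarrow> (nat list set \<times> nat list set) set" where
  "auxiliary_edges n = {(X, Y). X \<in> reeb_vertices n \<and> Y \<in> reeb_vertices n \<and>
     (\<exists>v\<in>X. \<exists>w\<in>Y. weak_less (n - 1) (deletion n w) (deletion n v) \<and>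
        \<not> weak_le n v w \<and> \<not> weak_le n w v)}"

definition augmented_reeb_edges :: "nat \<Rightarrow> (nat list set \<times> nat list set) set" where
  "augmented_reeb_edges n = reeb_edges n \<union> auxiliary_edges n"

definition right_of_max :: "nat \<Rightarrow> nat list \<Rightarrow> nat set" where
  "right_of_max n w = {i \<in> {1..n - 1}. \<exists>xs ys zs. w = xs @ [n] @ ys @ [i] @ zs}"

(* The map [w] |-> A(w) on classes, where A(w) is right_of_max n w.  It is meaningful because
   right_of_max n is constant on each class, which is a conjunct of the main statement. *)
definition vertex_label :: "nat \<Rightarrow> nat list set \<Rightarrow> nat set" where
  "vertex_label n X = the_elem (right_of_max n ` X)"

(* Reachability in the augmented graph, transported along vertex_label to subsets of {1..n-1}. *)
definition augmented_reeb_poset :: "nat \<Rightarrow> (nat set \<times> nat set) set" where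
  "augmented_reeb_poset n = {(vertex_label n X, vertex_label n Y) | X Y.
     X \<in> reeb_vertices n \<and> Y \<in> reeb_vertices n \<and> (X, Y) \<in> (augmented_reeb_edges n)\<^sup>*}"

definition \<nu> :: "nat set \<Rightarrow> nat" where
  "\<nu> A = (\<Sum>i\<in>A. 2 ^ (i - 1))"

end

theory Submission
  imports Defs
begin

text \<open>
  A permutation is determined by the relative order of its letters, and the weak order is
  containment of inversion sets (\<open>weak_le_iff_inversions\<close>). The inversions of a word \<open>w\<close> of
  \<open>S n\<close> split into those of \<open>deletion n w\<close> and the pairs \<open>(i, n)\<close> with \<open>i\<close> in
  \<open>A(w) = right_of_max n w\<close>. Covers add one inversion, so the vertical ones enlarge \<open>A\<close> by one
  element and the horizontal ones leave it fixed. Every fibre of \<open>A\<close> has a least element, and a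
  chain of covers inside a fibre has only horizontal steps; hence the fibres of \<open>A\<close> are exactly the
  classes of \<open>sim_h\<close>.

  The order by \<open>\<nu>\<close> compares binary expansions: \<open>\<nu> A < \<nu> B\<close> iff the largest element of the
  symmetric difference of \<open>A\<close> and \<open>B\<close> lies in \<open>B\<close>.

  Every edge increases this order (\<open>auxiliary_pair_increases_label\<close>). For an auxiliary edge
  from \<open>v\<close> to \<open>w\<close>, with labels \<open>A\<close> and \<open>B\<close>, incomparability forces some \<open>b\<close> in \<open>B - A\<close>. If the
  largest difference \<open>m\<close> were in \<open>A - B\<close>, then \<open>b < m\<close> would occur in the order \<open>b, n, m\<close> in \<open>v\<close> and
  \<open>m, n, b\<close> in \<open>w\<close>, so \<open>deletion n w\<close> would have an inversion that \<open>deletion n v\<close> lacks.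

  Conversely, let \<open>m\<close> be the largest difference and let it lie in \<open>B\<close>. Vertical edges lead from
  \<open>A\<close> to \<open>A \<union> {1..<m}\<close>; one edge performs the binary carry that removes \<open>{1..<m}\<close> and inserts
  \<open>m\<close> (\<open>carry_edge\<close>); the result is contained in \<open>B\<close>, so vertical edges lead on to \<open>B\<close>.
\<close>

section \<open>Relative order of letters\<close>

primrec precedes :: "'a list \<Rightarrow> 'a \<Rightarrow> 'a \<Rightarrow> bool" where
  "precedes [] x y \<longleftrightarrow> False"
| "precedes (c # w) x y \<longleftrightarrow> (x = c \<and> y \<in> set w) \<or> precedes w x y"

lemma precedes_append [simp]:
  "precedes (u @ v) x y \<longleftrightarrow> precedes u x y \<or> precedes v x y \<or> (x \<in> set u \<and> y \<in> set v)"
  by (induction u) auto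

lemma precedes_in_set: "precedes w x y \<Longrightarrow> x \<in> set w \<and> y \<in> set w"
  by (induction w) auto

lemma precedes_iff_split: "precedes w x y \<longleftrightarrow> (\<exists>xs ys zs. w = xs @ [x] @ ys @ [y] @ zs)"
proof
  show "precedes w x y \<Longrightarrow> \<exists>xs ys zs. w = xs @ [x] @ ys @ [y] @ zs"
  proof (induction w)
    case (Cons c w)
    show ?case
    proof (cases "precedes w x y")
      case True
      with Cons.IH obtain xs ys zs where "w = xs @ [x] @ ys @ [y] @ zs" by blast
      then have "c # w = (c # xs) @ [x] @ ys @ [y] @ zs" by simp
      then show ?thesis by blast
    next
      case False
      with Cons.prems have "x = c" "y \<in> set w" by auto
      then obtain ys zs where "w = ys @ y # zs" by (meson split_list)
      with \<open>x = c\<close> have "c # w = [] @ [x] @ ys @ [y] @ zs" by simp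
      then show ?thesis by blast
    qed
  qed simp
qed auto

lemma precedes_asym: "distinct w \<Longrightarrow> precedes w x y \<Longrightarrow> \<not> precedes w y x"
  by (induction w) (auto dest: precedes_in_set)

lemma precedes_total:
  "x \<in> set w \<Longrightarrow> y \<in> set w \<Longrightarrow> x \<noteq> y \<Longrightarrow> precedes w x y \<or> precedes w y x"
  by (induction w) auto

lemma precedes_trans: "precedes w x y \<Longrightarrow> precedes w y z \<Longrightarrow> distinct w \<Longrightarrow> precedes w x z"
  by (induction w) (auto dest: precedes_in_set)

lemma precedes_filter: "precedes (filter P w) x y \<longleftrightarrow> P x \<and> P y \<and> precedes w x y"
  by (induction w) auto

lemma precedes_removeAll [simp]:
  "precedes (removeAll c w) x y \<longleftrightarrow> x \<noteq> c \<and> y \<noteq> c \<and> precedes w x y"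
  unfolding removeAll_filter_not_eq precedes_filter by blast

lemma precedes_sorted: "sorted_wrt (<) w \<Longrightarrow> precedes w x y \<Longrightarrow> x < y"
  by (induction w) auto

lemma precedes_determines_list:
  assumes "distinct u" "distinct v" "set u = set v" "\<And>x y. precedes u x y \<Longrightarrow> precedes v x y"
  shows "u = v"
  using assms
proof (induction u arbitrary: v)
  case (Cons c u)
  then obtain d v' where v: "v = d # v'" by (cases v) auto
  have "c = d"
  proof (rule ccontr)
    assume "c \<noteq> d"
    then have "d \<in> set u" using Cons.prems(3) v by auto
    then have "precedes v c d" using Cons.prems(4) by simp
    then show False using Cons.prems(2) v \<open>c \<noteq> d\<close> by (auto dest: precedes_in_set)
  qed
  moreover have "u = v'"
  proof (rule Cons.IH)
    show "set u = set v'" using Cons.prems(1-3) v \<open>c = d\<close> by (simp add: insert_ident)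
    show "precedes v' x y" if "precedes u x y" for x y
    proof -
      have "x \<noteq> c" using that Cons.prems(1) by (auto dest: precedes_in_set)
      then show ?thesis using Cons.prems(4)[of x y] that v \<open>c = d\<close> by auto
    qed
  qed (use Cons.prems(1,2) v in auto)
  ultimately show ?case using v by simp
qed simp

text \<open>Since \<open>precedes v\<close> is transitive, comparing \<open>u\<close> with \<open>v\<close> on adjacent letters is enough.\<close>

lemma adjacent_precedes_imp_precedes:
  assumes "\<And>xs a b ys. u = xs @ [a, b] @ ys \<Longrightarrow> precedes v a b" "distinct v" "precedes u x y"
  shows "precedes v x y"
  using assms
proof (induction u arbitrary: x y)
  case (Cons c u)
  have IH: "precedes v x' y'" if "precedes u x' y'" for x' y'
  proof (rule Cons.IH[OF _ Cons.prems(2) that])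
    show "precedes v a b" if "u = xs @ [a, b] @ ys" for xs a b ys
      using Cons.prems(1)[of "c # xs" a b ys] that by simp
  qed
  show ?case
  proof (cases "precedes u x y")
    case True
    then show ?thesis by (rule IH)
  next
    case False
    with Cons.prems(3) have x: "x = c" and y: "y \<in> set u" by auto
    then obtain d u' where u: "u = d # u'" by (cases u) auto
    have cd: "precedes v c d" using Cons.prems(1)[of "[]" c d u'] u by simp
    show ?thesis
    proof (cases "y = d")
      case True
      then show ?thesis using cd x by simp
    next
      case False
      then have "precedes u d y" using y u by simp
      then have "precedes v d y" by (rule IH)
      then show ?thesis using precedes_trans[OF cd _ Cons.prems(2)] x by simp
    qed
  qed
qed simp

section \<open>The weak order as containment of inversions\<close>

lemma permutations_iff: "w \<in> permutations_of_set X \<longleftrightarrow> distinct w \<and> set w = X"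
  by (auto simp: permutations_of_set_def)

lemma weak_cover_precedes:
  assumes "(u, v) \<in> weak_cover n"
  obtains a b where "a < b" "precedes u a b" "\<not> precedes u b a"
    "\<And>x y. precedes v x y \<longleftrightarrow> (x = b \<and> y = a) \<or> (precedes u x y \<and> \<not> (x = a \<and> y = b))"
proof -
  obtain xs a b ys where ab: "a < b" and u: "u = xs @ [a, b] @ ys" and v: "v = xs @ [b, a] @ ys"
    and "u \<in> S n" using assms by (auto simp: weak_cover_def)
  then have d: "distinct u" by (simp add: permutations_iff)
  show thesis
  proof (rule that[OF ab])
    show p: "precedes u a b" using u by simp
    show "\<not> precedes u b a" using precedes_asym[OF d p] .
    show "precedes v x y \<longleftrightarrow> (x = b \<and> y = a) \<or> (precedes u x y \<and> \<not> (x = a \<and> y = b))" for x y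
      using d ab unfolding u v by (auto dest: precedes_in_set)
  qed
qed

lemma weak_le_preserves_inversion:
  assumes "weak_le n u v" "a < b" "precedes u b a"
  shows "precedes v b a"
proof -
  have "(u, v) \<in> (weak_cover n)\<^sup>*" using assms(1) by (simp add: weak_le_def)
  then show ?thesis
  proof (induction rule: rtrancl_induct)
    case (step y z)
    then show ?case using assms(2) by (auto elim!: weak_cover_precedes)
  qed (rule assms(3))
qed

text \<open>If \<open>u \<noteq> v\<close>, some adjacent pair of \<open>u\<close> stands in the opposite order in \<open>v\<close>. As \<open>v\<close> has all
  inversions of \<open>u\<close>, this pair is ascending, and swapping it gives a cover of \<open>u\<close> whose inversions
  are still among those of \<open>v\<close>. The number of missing inversions drops by one.\<close>

lemma inversions_subset_imp_weak_le:
  assumes "u \<in> S n" "v \<in> S n" "\<And>a b. a < b \<Longrightarrow> precedes u b a \<Longrightarrow> precedes v b a"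
  shows "weak_le n u v"
  using assms
proof (induction "card {(a, b). a < b \<and> precedes v b a \<and> \<not> precedes u b a}"
    arbitrary: u rule: less_induct)
  case less
  have du: "distinct u" and dv: "distinct v" and su: "set u = {1..n}" and sv: "set v = {1..n}"
    using less.prems by (auto simp: permutations_iff)
  show ?case
  proof (cases "u = v")
    case True
    then show ?thesis using less.prems by (simp add: weak_le_def)
  next
    case False
    then obtain x y where "precedes u x y" "\<not> precedes v x y"
      using precedes_determines_list[OF du dv] su sv by blast
    then obtain xs a b ys where u: "u = xs @ [a, b] @ ys" and "\<not> precedes v a b"
      using adjacent_precedes_imp_precedes[OF _ dv] by blast
    have "a \<in> set v" "b \<in> set v" "a \<noteq> b" using u du su sv by auto
    then have vba: "precedes v b a" using precedes_total[of a v b] \<open>\<not> precedes v a b\<close> by blast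
    have "a < b"
    proof (rule ccontr)
      assume "\<not> a < b"
      then have "b < a" using u du by auto
      then show False using less.prems(3)[of b a] u \<open>\<not> precedes v a b\<close> by simp
    qed
    define u' where "u' = xs @ [b, a] @ ys"
    have u': "u' \<in> S n" using du su by (auto simp: u u'_def permutations_iff)
    have cov: "(u, u') \<in> weak_cover n"
      using u' less.prems(1) \<open>a < b\<close> u by (auto simp: weak_cover_def u'_def)
    have nba: "\<not> precedes u b a" using precedes_asym[OF du, of a b] u by simp
    have prec': "precedes u' x y \<longleftrightarrow> (x = b \<and> y = a) \<or> (precedes u x y \<and> \<not> (x = a \<and> y = b))"
      for x y
      using du unfolding u u'_def by (auto dest: precedes_in_set)
    let ?M = "\<lambda>t. {(a, b). a < b \<and> precedes v b a \<and> \<not> precedes t b a}"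
    have "?M u' \<subset> ?M u"
    proof
      show "?M u' \<subseteq> ?M u" using \<open>a < b\<close> by (auto simp: prec')
      have "(a, b) \<in> ?M u" "(a, b) \<notin> ?M u'" using \<open>a < b\<close> vba nba by (auto simp: prec')
      then show "?M u' \<noteq> ?M u" by blast
    qed
    moreover have "finite (?M u)"
      by (rule finite_subset[of _ "set v \<times> set v"]) (auto dest: precedes_in_set)
    ultimately have "card (?M u') < card (?M u)" by (rule psubset_card_mono[rotated])
    moreover have "precedes v d c" if "c < d" "precedes u' d c" for c d
      using that less.prems(3) vba by (auto simp: prec')
    ultimately have "weak_le n u' v" using less.hyps u' less.prems(2) by blast
    then show ?thesis
      using cov less.prems(1) by (auto simp: weak_le_def intro: converse_rtrancl_into_rtrancl)
  qed
qed

lemma weak_le_iff_inversions: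
  assumes "u \<in> S n" "v \<in> S n"
  shows "weak_le n u v \<longleftrightarrow> (\<forall>a b. a < b \<longrightarrow> precedes u b a \<longrightarrow> precedes v b a)"
proof
  show "weak_le n u v \<Longrightarrow> \<forall>a b. a < b \<longrightarrow> precedes u b a \<longrightarrow> precedes v b a"
    by (intro allI impI) (rule weak_le_preserves_inversion)
  show "\<forall>a b. a < b \<longrightarrow> precedes u b a \<longrightarrow> precedes v b a \<Longrightarrow> weak_le n u v"
    by (rule inversions_subset_imp_weak_le[OF assms]) blast
qed

section \<open>Horizontal classes are the fibres of the label\<close>

lemma right_of_max_iff:
  assumes "w \<in> S n"
  shows "i \<in> right_of_max n w \<longleftrightarrow> precedes w n i"
proof
  show "i \<in> right_of_max n w \<Longrightarrow> precedes w n i"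
    unfolding right_of_max_def precedes_iff_split by blast
  assume p: "precedes w n i"
  then have "i \<noteq> n" "i \<in> {1..n}"
    using assms precedes_asym[of w n n] precedes_in_set[OF p] by (auto simp: permutations_iff)
  then show "i \<in> right_of_max n w"
    using p unfolding right_of_max_def precedes_iff_split by auto
qed

lemma right_of_max_subset: "right_of_max n w \<subseteq> {1..n - 1}"
  by (auto simp: right_of_max_def)

lemma right_of_max_split:
  assumes "P @ n # Q \<in> S n"
  shows "right_of_max n (P @ n # Q) = set Q"
proof -
  have "n \<notin> set P" "n \<notin> set Q" using assms by (auto simp: permutations_iff)
  then have "precedes (P @ n # Q) n i \<longleftrightarrow> i \<in> set Q" for i
    using precedes_in_set[of P n i] precedes_in_set[of Q n i] by auto
  then show ?thesis using right_of_max_iff[OF assms] by blast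
qed

lemma deletion_in_S: "w \<in> S n \<Longrightarrow> deletion n w \<in> S (n - 1)"
proof -
  assume w: "w \<in> S n"
  have "{1..n} - {n} = {1..n - 1}" by auto
  then show ?thesis using w unfolding permutations_iff deletion_def by (simp only: set_removeAll distinct_removeAll)
qed

lemma weak_cover_irrefl: "(u, u) \<notin> weak_cover n"
  by (meson weak_cover_precedes)

lemma weak_cover_label_mono:
  assumes "(u, v) \<in> weak_cover n"
  shows "right_of_max n u \<subseteq> right_of_max n v"
proof -
  have S: "u \<in> S n" "v \<in> S n" using assms by (auto simp: weak_cover_def)
  show ?thesis
  proof
    fix i
    assume i: "i \<in> right_of_max n u"
    then have "i < n" by (auto simp: right_of_max_def)
    moreover have "weak_le n u v" using assms S by (auto simp: weak_le_def)
    ultimately show "i \<in> right_of_max n v"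
      using i S weak_le_preserves_inversion by (simp add: right_of_max_iff)
  qed
qed

text \<open>The swapped letters \<open>a < b\<close> involve \<open>n\<close> only if \<open>b = n\<close>; then \<open>a\<close> moves to the right of \<open>n\<close>
  and the deletion does not change.\<close>

lemma weak_cover_cases:
  assumes "(u, v) \<in> weak_cover n"
  shows "(u, v) \<in> horizontal_cover n \<and> right_of_max n v = right_of_max n u \<or>
    (u, v) \<in> vertical_cover n \<and> right_of_max n u \<subset> right_of_max n v"
proof -
  obtain xs a b ys where ab: "a < b" and u: "u = xs @ [a, b] @ ys" and v: "v = xs @ [b, a] @ ys"
    and S: "u \<in> S n" "v \<in> S n" using assms by (auto simp: weak_cover_def)
  have d: "distinct u" and "b \<le> n" using S u by (auto simp: permutations_iff)
  show ?thesis
  proof (cases "b = n")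
    case True
    have "a \<in> right_of_max n v" using True v S by (simp add: right_of_max_iff)
    moreover have "a \<notin> right_of_max n u"
      using True u S precedes_asym[OF d, of a b] by (simp add: right_of_max_iff)
    ultimately have "right_of_max n u \<subset> right_of_max n v"
      using weak_cover_label_mono[OF assms] by blast
    moreover have "(u, v) \<in> vertical_cover n"
      using assms True ab by (auto simp: vertical_cover_def deletion_def u v)
    ultimately show ?thesis by blast
  next
    case False
    with \<open>b \<le> n\<close> ab have n: "a \<noteq> n" "b \<noteq> n" by auto
    then have "deletion n u = removeAll n xs @ [a, b] @ removeAll n ys"
      "deletion n v = removeAll n xs @ [b, a] @ removeAll n ys"
      by (auto simp: u v deletion_def)
    then have "(deletion n u, deletion n v) \<in> weak_cover (n - 1)"
      using ab deletion_in_S[OF S(1)] deletion_in_S[OF S(2)] unfolding weak_cover_def by blast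
    then have "(u, v) \<in> horizontal_cover n" using assms by (simp add: horizontal_cover_def)
    moreover have "right_of_max n v = right_of_max n u"
      using n S by (auto simp: set_eq_iff right_of_max_iff u v)
    ultimately show ?thesis by blast
  qed
qed

lemma horizontal_cover_label:
  assumes "(u, v) \<in> horizontal_cover n"
  shows "right_of_max n u = right_of_max n v"
proof -
  have c: "(u, v) \<in> weak_cover n" and "deletion n u \<noteq> deletion n v"
    using assms weak_cover_irrefl by (auto simp: horizontal_cover_def)
  then have "(u, v) \<notin> vertical_cover n" by (auto simp: vertical_cover_def)
  then show ?thesis using weak_cover_cases[OF c] by blast
qed

lemma vertical_cover_label:
  assumes "(u, v) \<in> vertical_cover n"
  shows "right_of_max n u \<subset> right_of_max n v"
proof -
  have c: "(u, v) \<in> weak_cover n" and "deletion n u = deletion n v"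
    using assms by (auto simp: vertical_cover_def)
  then have "(u, v) \<notin> horizontal_cover n"
    using weak_cover_irrefl[of "deletion n v" "n - 1"] by (simp add: horizontal_cover_def)
  then show ?thesis using weak_cover_cases[OF c] by blast
qed

text \<open>Labels grow along a chain of covers, so equal labels at the ends leave no room for a vertical
  step in between.\<close>

lemma weak_le_same_label_imp_horizontal:
  assumes "weak_le n u v" "right_of_max n u = right_of_max n v"
  shows "(u, v) \<in> (horizontal_cover n)\<^sup>*"
proof -
  have "right_of_max n u \<subseteq> right_of_max n v \<and>
      (right_of_max n u = right_of_max n v \<longrightarrow> (u, v) \<in> (horizontal_cover n)\<^sup>*)"
    if "(u, v) \<in> (weak_cover n)\<^sup>*" for v
    using that
  proof (induction rule: rtrancl_induct)
    case (step y z)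
    from weak_cover_cases[OF step(2)] show ?case
    proof (elim disjE conjE)
      assume "(y, z) \<in> horizontal_cover n" "right_of_max n z = right_of_max n y"
      then show ?case using step.IH by (metis rtrancl_into_rtrancl)
    next
      assume "right_of_max n y \<subset> right_of_max n z"
      then show ?case using step.IH by blast
    qed
  qed simp
  then show ?thesis using assms by (simp add: weak_le_def)
qed

definition label_fibre :: "nat \<Rightarrow> nat set \<Rightarrow> nat list set" where
  "label_fibre n A = {w \<in> S n. right_of_max n w = A}"

definition least_word :: "nat \<Rightarrow> nat set \<Rightarrow> nat list" where
  "least_word n A = sorted_list_of_set ({1..n - 1} - A) @ n # sorted_list_of_set A"

lemma least_word_in_fibre:
  assumes "0 < n" "A \<subseteq> {1..n - 1}"
  shows "least_word n A \<in> label_fibre n A"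
proof -
  have fin: "finite A" using assms(2) finite_subset by blast
  have "n \<notin> A" "insert n ({1..n - 1} \<union> A) = {1..n}" using assms by fastforce+
  then have "least_word n A \<in> S n"
    using fin assms(1) by (auto simp: permutations_iff least_word_def)
  moreover from this have "right_of_max n (least_word n A) = A"
    using right_of_max_split fin unfolding least_word_def by auto
  ultimately show ?thesis by (simp add: label_fibre_def)
qed

text \<open>In every word with label \<open>A\<close>, the letters outside \<open>A\<close> precede \<open>n\<close>, which precedes those in
  \<open>A\<close>. The least word has only the inversions that this forces.\<close>

lemma least_word_le:
  assumes "0 < n" "w \<in> S n" "right_of_max n w = A"
  shows "weak_le n (least_word n A) w"
proof (rule inversions_subset_imp_weak_le)
  have A: "A \<subseteq> {1..n - 1}" using assms(3) right_of_max_subset by blast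
  then have fin: "finite A" using finite_subset by blast
  show "least_word n A \<in> S n" using least_word_in_fibre[OF assms(1) A] by (simp add: label_fibre_def)
  show "w \<in> S n" by (rule assms(2))
  have dw: "distinct w" and sw: "set w = {1..n}" using assms(2) by (auto simp: permutations_iff)
  have after: "precedes w n y" if "y \<in> A" for y
    using that assms by (auto simp: right_of_max_iff)
  have before: "precedes w x n" if "x \<in> {1..n - 1} - A" for x
  proof -
    have "x \<in> set w" "n \<in> set w" "x \<noteq> n" using that sw assms(1) by auto
    moreover have "\<not> precedes w n x" using that assms by (auto simp: right_of_max_iff)
    ultimately show ?thesis using precedes_total by metis
  qed
  fix a b
  assume "a < b" and p: "precedes (least_word n A) b a"
  have no_inv: "\<not> precedes (sorted_list_of_set X) b a" for X :: "nat set"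
    using precedes_sorted[OF strict_sorted_list_of_set, of X b a] \<open>a < b\<close> by auto
  have "a \<in> A \<and> (b = n \<or> b \<in> {1..n - 1} - A) \<or> a = n \<and> b \<in> {1..n - 1} - A"
    using p no_inv fin by (auto simp: least_word_def)
  then show "precedes w b a"
    using after before precedes_trans[OF _ _ dw] by blast
qed

lemma sim_h_class_eq_fibre:
  assumes "0 < n" "w \<in> S n"
  shows "sim_h n `` {w} = label_fibre n (right_of_max n w)"
proof (intro subset_antisym subsetI)
  let ?H = "horizontal_cover n \<union> (horizontal_cover n)\<inverse>"
  fix v
  assume "v \<in> sim_h n `` {w}"
  then have "(w, v) \<in> ?H\<^sup>*" and v: "v \<in> S n" by (auto simp: sim_h_def)
  from this(1) have "right_of_max n v = right_of_max n w"
    by (induction rule: rtrancl_induct) (auto dest: horizontal_cover_label)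
  then show "v \<in> label_fibre n (right_of_max n w)" using v by (simp add: label_fibre_def)
next
  let ?H = "horizontal_cover n \<union> (horizontal_cover n)\<inverse>"
  fix v
  assume "v \<in> label_fibre n (right_of_max n w)"
  then have v: "v \<in> S n" and lab: "right_of_max n v = right_of_max n w"
    by (auto simp: label_fibre_def)
  let ?m = "least_word n (right_of_max n w)"
  have m: "right_of_max n ?m = right_of_max n w"
    using least_word_in_fibre[OF assms(1) right_of_max_subset] by (simp add: label_fibre_def)
  have "(?m, w) \<in> (horizontal_cover n)\<^sup>*" "(?m, v) \<in> (horizontal_cover n)\<^sup>*"
    using weak_le_same_label_imp_horizontal least_word_le[OF assms(1)] assms(2) v lab m by metis+
  then have "(w, ?m) \<in> ((horizontal_cover n)\<inverse>)\<^sup>*" "(?m, v) \<in> (horizontal_cover n)\<^sup>*"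
    by (auto simp: rtrancl_converse)
  then have "(w, ?m) \<in> ?H\<^sup>*" "(?m, v) \<in> ?H\<^sup>*"
    by (meson in_mono rtrancl_mono sup_ge1 sup_ge2)+
  then show "v \<in> sim_h n `` {w}" using assms(2) v by (auto simp: sim_h_def)
qed

lemma vertex_label_fibre:
  assumes "0 < n" "A \<subseteq> {1..n - 1}"
  shows "vertex_label n (label_fibre n A) = A"
proof -
  have "right_of_max n ` label_fibre n A = {A}"
    using least_word_in_fibre[OF assms] by (auto simp: label_fibre_def)
  then show ?thesis by (simp add: vertex_label_def)
qed

lemma reeb_vertices_eq_fibres:
  assumes "0 < n"
  shows "reeb_vertices n = label_fibre n ` Pow {1..n - 1}"
proof -
  have "reeb_vertices n = (\<lambda>w. sim_h n `` {w}) ` S n" by (auto simp: reeb_vertices_def quotient_def)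
  also have "\<dots> = label_fibre n ` right_of_max n ` S n"
    using sim_h_class_eq_fibre[OF assms] by (simp add: image_image)
  also have "right_of_max n ` S n = Pow {1..n - 1}"
  proof (intro subset_antisym subsetI)
    fix A
    assume "A \<in> Pow {1..n - 1}"
    then have "least_word n A \<in> S n" "right_of_max n (least_word n A) = A"
      using least_word_in_fibre[OF assms, of A] by (auto simp: label_fibre_def)
    then show "A \<in> right_of_max n ` S n" by (metis image_eqI)
  qed (use right_of_max_subset in blast)
  finally show ?thesis .
qed

section \<open>Binary order on finite sets\<close>

lemma \<nu>_initial_segment: "0 < m \<Longrightarrow> \<nu> {1..<m} + 1 = 2 ^ (m - 1)"
proof (induction m rule: nat_induct_non_zero)
  case (Suc m)
  have "{1..<Suc m} = insert m {1..<m}" using Suc.hyps by auto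
  then have "\<nu> {1..<Suc m} + 1 = 2 ^ (m - 1) + (\<nu> {1..<m} + 1)" by (simp add: \<nu>_def)
  also have "\<dots> = 2 ^ (m - 1) + 2 ^ (m - 1)" using Suc.IH by simp
  also have "\<dots> = 2 ^ (Suc m - 1)" using Suc.hyps by (cases m) auto
  finally show ?case .
qed (simp add: \<nu>_def)

definition binary_less :: "nat set \<Rightarrow> nat set \<Rightarrow> bool" where
  "binary_less A B \<longleftrightarrow> (\<exists>m\<in>B - A. \<forall>i>m. i \<in> A \<longleftrightarrow> i \<in> B)"

text \<open>Above \<open>m\<close> the two sets contribute equally, and the digits below \<open>m\<close> sum to less than the
  digit at \<open>m\<close>.\<close>

lemma binary_less_imp_\<nu>_less:
  assumes "finite A" "finite B" "A \<subseteq> {1..}" "B \<subseteq> {1..}" "binary_less A B"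
  shows "\<nu> A < \<nu> B"
proof -
  obtain m where m: "m \<in> B" "m \<notin> A" "\<And>i. m < i \<Longrightarrow> i \<in> A \<longleftrightarrow> i \<in> B"
    using assms(5) by (auto simp: binary_less_def)
  have "m > 0" using m(1) assms(4) by auto
  have "A = (A \<inter> {1..<m}) \<union> (B \<inter> {m<..})"
  proof (rule set_eqI)
    fix i
    show "i \<in> A \<longleftrightarrow> i \<in> (A \<inter> {1..<m}) \<union> (B \<inter> {m<..})"
      using subsetD[OF assms(3), of i] m(2) m(3)[of i] by (cases i m rule: linorder_cases) auto
  qed
  then have "\<nu> A = \<nu> ((A \<inter> {1..<m}) \<union> (B \<inter> {m<..}))" by simp
  also have "\<dots> = \<nu> (A \<inter> {1..<m}) + \<nu> (B \<inter> {m<..})"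
    unfolding \<nu>_def by (rule sum.union_disjoint) (use assms in auto)
  also have "\<nu> (A \<inter> {1..<m}) \<le> \<nu> {1..<m}"
    unfolding \<nu>_def by (rule sum_mono2) auto
  also have "\<nu> {1..<m} < 2 ^ (m - 1)" using \<nu>_initial_segment[OF \<open>m > 0\<close>] by simp
  also have "2 ^ (m - 1) + \<nu> (B \<inter> {m<..}) = \<nu> (insert m (B \<inter> {m<..}))"
    using assms(2) by (simp add: \<nu>_def)
  also have "\<dots> \<le> \<nu> B"
    unfolding \<nu>_def by (rule sum_mono2) (use assms(2) m in auto)
  finally show ?thesis by simp
qed

lemma binary_less_linear:
  assumes "finite A" "finite B" "A \<noteq> B"
  shows "binary_less A B \<or> binary_less B A"
proof -
  let ?D = "(A - B) \<union> (B - A)"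
  have D: "finite ?D" "?D \<noteq> {}" using assms by auto
  have "Max ?D \<in> ?D" using Max_in[OF D] .
  moreover have "i \<in> A \<longleftrightarrow> i \<in> B" if "Max ?D < i" for i
    using that Max_ge[OF D(1), of i] by auto
  ultimately show ?thesis unfolding binary_less_def by blast
qed

lemma \<nu>_less_iff_binary_less:
  assumes "A \<subseteq> {1..k}" "B \<subseteq> {1..k}"
  shows "\<nu> A < \<nu> B \<longleftrightarrow> binary_less A B"
proof -
  have "finite A" "finite B" "A \<subseteq> {1..}" "B \<subseteq> {1..}" using assms finite_subset by auto
  then show ?thesis
    using binary_less_imp_\<nu>_less[of A B] binary_less_imp_\<nu>_less[of B A] binary_less_linear[of A B]
    by fastforce
qed

lemma inj_on_\<nu>: "inj_on \<nu> (Pow {1..k})"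
proof (rule inj_onI)
  fix A B
  assume *: "A \<in> Pow {1..k}" "B \<in> Pow {1..k}" "\<nu> A = \<nu> B"
  then have "finite A" "finite B" using finite_subset by auto
  then show "A = B"
    using binary_less_linear[of A B] \<nu>_less_iff_binary_less[of A k B] \<nu>_less_iff_binary_less[of B k A] *
    by auto
qed

section \<open>Edges increase the binary order\<close>

lemma auxiliary_pair_increases_label:
  assumes n: "0 < n" and v: "v \<in> S n" and w: "w \<in> S n"
    and le: "weak_le (n - 1) (deletion n w) (deletion n v)" and nle: "\<not> weak_le n w v"
  shows "binary_less (right_of_max n v) (right_of_max n w)"
proof -
  let ?A = "right_of_max n v" and ?B = "right_of_max n w"
  have d: "distinct v" "distinct w" "set v = {1..n}" "set w = {1..n}"
    using v w by (auto simp: permutations_iff)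
  have inv: "precedes v b a" if "a < b" "b < n" "precedes w b a" for a b
    using weak_le_preserves_inversion[OF le, of a b] that by (simp add: deletion_def)
  \<comment> \<open>Some inversion of \<open>w\<close> is missing in \<open>v\<close>, and by \<open>inv\<close> it must involve \<open>n\<close>.\<close>
  obtain b where b: "b \<in> ?B" "b \<notin> ?A"
  proof -
    obtain a c where "a < c" "precedes w c a" "\<not> precedes v c a"
      using nle weak_le_iff_inversions[OF w v] by blast
    moreover from this have "c \<le> n" using precedes_in_set d(4) by fastforce
    ultimately have "c = n" using inv[of a c] by (metis le_neq_implies_less)
    then show thesis
      using that[of a] v w \<open>precedes w c a\<close> \<open>\<not> precedes v c a\<close> by (simp add: right_of_max_iff)
  qed
  have "\<not> binary_less ?B ?A"
  proof
    assume "binary_less ?B ?A"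
    then obtain m where m: "m \<in> ?A" "m \<notin> ?B" "\<And>i. m < i \<Longrightarrow> i \<in> ?B \<longleftrightarrow> i \<in> ?A"
      by (auto simp: binary_less_def)
    have "b < m" using b m by (metis nat_neq_iff)
    have range: "b \<in> {1..n - 1}" "m \<in> {1..n - 1}" using b(1) m(1) right_of_max_subset by blast+
    then have "m < n" using n by auto
    have in_range: "b \<in> {1..n}" "m \<in> {1..n}" "n \<in> {1..n}" "b \<noteq> n" "m \<noteq> n" using range n by auto
    have "precedes v b n" "precedes v n m" "precedes w m n" "precedes w n b"
      using b m v w d in_range precedes_total[of b v n] precedes_total[of m w n]
      by (auto simp: right_of_max_iff)
    then have "precedes v b m" "precedes w m b" using precedes_trans d by metis+
    then show False using inv[OF \<open>b < m\<close> \<open>m < n\<close>] precedes_asym d by metis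
  qed
  moreover have "finite ?A" "finite ?B" using right_of_max_subset finite_subset by blast+
  ultimately show ?thesis using b binary_less_linear[of ?A ?B] by blast
qed

lemma edge_increases_\<nu>:
  assumes n: "0 < n" and e: "(label_fibre n A, label_fibre n B) \<in> augmented_reeb_edges n"
    and AB: "A \<subseteq> {1..n - 1}" "B \<subseteq> {1..n - 1}"
  shows "\<nu> A < \<nu> B"
proof -
  from e consider (vertical) v w where "v \<in> label_fibre n A" "w \<in> label_fibre n B"
      "(v, w) \<in> vertical_cover n"
    | (auxiliary) v w where "v \<in> label_fibre n A" "w \<in> label_fibre n B"
      "weak_le (n - 1) (deletion n w) (deletion n v)" "\<not> weak_le n w v"
    unfolding augmented_reeb_edges_def reeb_edges_def auxiliary_edges_def weak_less_def by blast
  then show ?thesis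
  proof cases
    case vertical
    have "A \<subset> B" using vertical_cover_label[OF vertical(3)] vertical(1,2) by (simp add: label_fibre_def)
    moreover have "finite A" "finite B" using AB finite_subset by blast+
    ultimately have "binary_less A B"
      using binary_less_linear[of A B] by (auto simp: binary_less_def)
    then show ?thesis using \<nu>_less_iff_binary_less AB by blast
  next
    case auxiliary
    then have "binary_less A B"
      using auxiliary_pair_increases_label[OF n] by (auto simp: label_fibre_def)
    then show ?thesis using \<nu>_less_iff_binary_less AB by blast
  qed
qed

section \<open>The binary order is reached by edges\<close>

lemma insert_edge:
  assumes "0 < n" "insert a A \<subseteq> {1..n - 1}" "a \<notin> A"
  shows "(label_fibre n A, label_fibre n (insert a A)) \<in> augmented_reeb_edges n"
proof -
  let ?P = "sorted_list_of_set ({1..n - 1} - insert a A)" and ?Q = "sorted_list_of_set A"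
  let ?v = "?P @ [a, n] @ ?Q" and ?w = "?P @ [n, a] @ ?Q"
  have fin: "finite A" using finite_subset[of A "{1..n - 1}"] assms(2) by auto
  have sets: "set ?P = {1..n - 1} - insert a A" "set ?Q = A" using fin by auto
  have univ: "{1..n} = ({1..n - 1} - insert a A) \<union> {a} \<union> {n} \<union> A"
  proof (rule set_eqI)
    fix i
    show "i \<in> {1..n} \<longleftrightarrow> i \<in> ({1..n - 1} - insert a A) \<union> {a} \<union> {n} \<union> A"
      using subsetD[OF assms(2), of i] assms(1) by (cases "i = n") auto
  qed
  have "n \<notin> insert a A" using subsetD[OF assms(2), of n] assms(1) by auto
  then have dist: "distinct ?v" "distinct ?w" using assms(1,3) by (auto simp: sets)
  have "set ?v = {1..n}" "set ?w = {1..n}" unfolding univ set_append list.set sets by blast+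
  then have S: "?v \<in> S n" "?w \<in> S n" using dist unfolding permutations_iff by blast+
  have "right_of_max n ?v = A" using right_of_max_split[of "?P @ [a]" n ?Q] S fin by simp
  moreover have "right_of_max n ?w = insert a A" using right_of_max_split[of ?P n "a # ?Q"] S fin by simp
  moreover have "a < n" using assms by auto
  then have "(?v, ?w) \<in> weak_cover n" using S unfolding weak_cover_def by blast
  then have "(?v, ?w) \<in> vertical_cover n" by (simp add: vertical_cover_def deletion_def)
  ultimately show ?thesis
    using S assms unfolding augmented_reeb_edges_def reeb_edges_def reeb_vertices_eq_fibres[OF assms(1)]
    by (auto simp: label_fibre_def)
qed

lemma subset_reachable:
  assumes "0 < n" "A \<subseteq> B" "B \<subseteq> {1..n - 1}"
  shows "(label_fibre n A, label_fibre n B) \<in> (augmented_reeb_edges n)\<^sup>*"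
proof -
  have "(label_fibre n A, label_fibre n (A \<union> C)) \<in> (augmented_reeb_edges n)\<^sup>*"
    if "finite C" "C \<subseteq> B - A" for C
    using that
  proof (induction C rule: finite_induct)
    case (insert c C)
    have "(label_fibre n (A \<union> C), label_fibre n (insert c (A \<union> C))) \<in> augmented_reeb_edges n"
      by (rule insert_edge) (use insert assms in auto)
    then show ?case using insert by (auto intro: rtrancl_into_rtrancl)
  qed simp
  from this[of "B - A"] show ?thesis
    using assms finite_subset[of "B - A" "{1..n - 1}"] by (auto simp: Un_absorb1)
qed

text \<open>Let \<open>D\<close> and \<open>C\<close> list the elements above \<open>m\<close> outside and inside \<open>A\<close>, and \<open>L\<close> those below \<open>m\<close>.
  The words \<open>D m n L C\<close> and \<open>L D n m C\<close> have the two labels. Their deletions \<open>D m L C\<close> and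
  \<open>L D m C\<close> differ only in the small letters \<open>L\<close> moving to the front, which removes inversions.\<close>

lemma carry_edge:
  assumes n: "0 < n" and A: "A \<subseteq> {1..n - 1}" and m: "m \<in> {1..n - 1}" "m \<notin> A"
    and low: "{1..<m} \<subseteq> A"
  shows "(label_fibre n A, label_fibre n (insert m (A \<inter> {m<..}))) \<in> augmented_reeb_edges n"
proof (cases "m = 1")
  case True
  \<comment> \<open>Here nothing is removed, and the two deletions would coincide.\<close>
  then have "A \<inter> {m<..} = A" using subsetD[OF A] m(2) by (force simp: less_le)
  then show ?thesis using insert_edge[of n m A] assms by simp
next
  case False
  then have "1 < m" using m by auto
  have fin: "finite A" using A finite_subset by blast
  let ?L = "[1..<m]" and ?D = "sorted_list_of_set ({m<..n - 1} - A)"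
    and ?C = "sorted_list_of_set (A \<inter> {m<..})"
  let ?v = "(?D @ [m]) @ n # ?L @ ?C" and ?w = "(?L @ ?D) @ n # m # ?C"
  have A_eq: "A = {1..<m} \<union> (A \<inter> {m<..})"
  proof (rule set_eqI)
    fix i
    show "i \<in> A \<longleftrightarrow> i \<in> {1..<m} \<union> (A \<inter> {m<..})"
      using subsetD[OF A, of i] subsetD[OF low, of i] m(2) by (cases i m rule: linorder_cases) auto
  qed
  have sets: "set ?L = {1..<m}" "set ?D = {m<..n - 1} - A" "set ?C = A \<inter> {m<..}"
    using fin by auto
  have univ: "{1..n} = {1..<m} \<union> {m} \<union> ({m<..n - 1} - A) \<union> {n} \<union> (A \<inter> {m<..})"
  proof (rule set_eqI)
    fix i
    show "i \<in> {1..n} \<longleftrightarrow> i \<in> {1..<m} \<union> {m} \<union> ({m<..n - 1} - A) \<union> {n} \<union> (A \<inter> {m<..})"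
      using subsetD[OF A, of i] m n by (cases i m rule: linorder_cases) auto
  qed
  have "n \<notin> A" "m < n" using subsetD[OF A, of n] m n by auto
  then have dist: "distinct ?v" "distinct ?w" using m by (auto simp: sets)
  have "set ?v = {1..n}" "set ?w = {1..n}" unfolding univ set_append list.set sets by blast+
  then have S: "?v \<in> S n" "?w \<in> S n" using dist unfolding permutations_iff by blast+
  have lab: "right_of_max n ?v = A" "right_of_max n ?w = insert m (A \<inter> {m<..})"
    using right_of_max_split[OF S(1)] right_of_max_split[OF S(2)] A_eq
    unfolding set_append list.set sets by blast+
  have "n \<notin> set ?D" "n \<notin> set ?C" "n \<notin> set ?L" "m \<noteq> n"
    using \<open>n \<notin> A\<close> \<open>m < n\<close> n unfolding sets by auto
  then have del: "deletion n ?v = (?D @ [m]) @ ?L @ ?C" "deletion n ?w = ?L @ (?D @ [m]) @ ?C"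
    by (auto simp: deletion_def)
  have "weak_le (n - 1) (deletion n ?w) (deletion n ?v)"
  proof (rule inversions_subset_imp_weak_le)
    show "deletion n ?w \<in> S (n - 1)" "deletion n ?v \<in> S (n - 1)" using deletion_in_S S by blast+
    fix a b :: nat
    assume "a < b" "precedes (deletion n ?w) b a"
    then show "precedes (deletion n ?v) b a"
      unfolding del precedes_append set_append sets by auto
  qed
  \<comment> \<open>The pair \<open>(1, m)\<close> is inverted in the first word only, the pair \<open>(m, n)\<close> in the second only.\<close>
  moreover have one: "precedes ?v m 1" "precedes ?w 1 m" "precedes ?w n m" "precedes ?v m n"
    using \<open>1 < m\<close> by auto
  moreover have "deletion n ?w \<noteq> deletion n ?v"
  proof
    assume eq: "deletion n ?w = deletion n ?v"
    have "precedes (deletion n ?w) 1 m" "precedes (deletion n ?v) m 1"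
      unfolding del using \<open>1 < m\<close> by auto
    moreover have "distinct (deletion n ?v)" using deletion_in_S[OF S(1)] by (simp add: permutations_iff)
    ultimately show False using eq precedes_asym by metis
  qed
  moreover have "\<not> weak_le n ?v ?w"
    using weak_le_preserves_inversion[OF _ \<open>1 < m\<close>, of n ?v ?w] one(1,2) precedes_asym[OF dist(2)]
    by blast
  moreover have "\<not> weak_le n ?w ?v"
    using \<open>m < n\<close> weak_le_preserves_inversion[of n ?w ?v m n] one(3,4) precedes_asym[OF dist(1)]
    by blast
  moreover have "?v \<in> label_fibre n A" "?w \<in> label_fibre n (insert m (A \<inter> {m<..}))"
    using S lab by (simp_all add: label_fibre_def)
  moreover have "label_fibre n A \<in> reeb_vertices n"
      "label_fibre n (insert m (A \<inter> {m<..})) \<in> reeb_vertices n"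
    unfolding reeb_vertices_eq_fibres[OF n] using A m by auto
  ultimately show ?thesis
    unfolding augmented_reeb_edges_def auxiliary_edges_def weak_less_def by blast
qed

lemma binary_less_reachable:
  assumes n: "0 < n" and A: "A \<subseteq> {1..n - 1}" and B: "B \<subseteq> {1..n - 1}" and less: "binary_less A B"
  shows "(label_fibre n A, label_fibre n B) \<in> (augmented_reeb_edges n)\<^sup>*"
proof -
  obtain m where m: "m \<in> B" "m \<notin> A" "\<And>i. m < i \<Longrightarrow> i \<in> A \<longleftrightarrow> i \<in> B"
    using less by (auto simp: binary_less_def)
  let ?A' = "A \<union> {1..<m}"
  let ?B' = "insert m (?A' \<inter> {m<..})"
  have A': "?A' \<subseteq> {1..n - 1}" using A B m(1) by force
  have "(label_fibre n A, label_fibre n ?A') \<in> (augmented_reeb_edges n)\<^sup>*"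
    by (rule subset_reachable[OF n _ A']) simp
  moreover have "(label_fibre n ?A', label_fibre n ?B') \<in> augmented_reeb_edges n"
    by (rule carry_edge[OF n A']) (use m B in auto)
  moreover have "(label_fibre n ?B', label_fibre n B) \<in> (augmented_reeb_edges n)\<^sup>*"
    by (rule subset_reachable[OF n _ B]) (use m in auto)
  ultimately show ?thesis by (meson converse_rtrancl_into_rtrancl rtrancl_trans)
qed

section \<open>The augmented Reeb poset\<close>

lemma reachable_imp_\<nu>_le:
  assumes n: "0 < n" and A: "A \<subseteq> {1..n - 1}" and B: "B \<subseteq> {1..n - 1}"
    and r: "(label_fibre n A, label_fibre n B) \<in> (augmented_reeb_edges n)\<^sup>*"
  shows "\<nu> A \<le> \<nu> B"
proof -
  have "\<exists>C\<subseteq>{1..n - 1}. Y = label_fibre n C \<and> \<nu> A \<le> \<nu> C"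
    if "(label_fibre n A, Y) \<in> (augmented_reeb_edges n)\<^sup>*" for Y
    using that
  proof (induction rule: rtrancl_induct)
    case base
    then show ?case using A by blast
  next
    case (step Y Z)
    then obtain C where C: "C \<subseteq> {1..n - 1}" "Y = label_fibre n C" "\<nu> A \<le> \<nu> C" by blast
    have "Z \<in> reeb_vertices n"
      using step(2) by (auto simp: augmented_reeb_edges_def reeb_edges_def auxiliary_edges_def)
    then obtain D where D: "D \<subseteq> {1..n - 1}" "Z = label_fibre n D"
      unfolding reeb_vertices_eq_fibres[OF n] by blast
    then have "\<nu> C < \<nu> D" using edge_increases_\<nu>[OF n _ C(1) D(1)] step(2) C(2) by simp
    then have "\<nu> A \<le> \<nu> D" using C(3) by simp
    then show ?case using D by blast
  qed
  from this[OF r] obtain C where "C \<subseteq> {1..n - 1}" "label_fibre n B = label_fibre n C" "\<nu> A \<le> \<nu> C"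
    by blast
  then show ?thesis using vertex_label_fibre[OF n] B by metis
qed

lemma augmented_reeb_poset_iff:
  assumes n: "0 < n"
  shows "(A, B) \<in> augmented_reeb_poset n \<longleftrightarrow> A \<subseteq> {1..n - 1} \<and> B \<subseteq> {1..n - 1} \<and> \<nu> A \<le> \<nu> B"
proof
  assume "(A, B) \<in> augmented_reeb_poset n"
  then obtain A' B' where "A' \<subseteq> {1..n - 1}" "B' \<subseteq> {1..n - 1}"
    "A = vertex_label n (label_fibre n A')" "B = vertex_label n (label_fibre n B')"
    "(label_fibre n A', label_fibre n B') \<in> (augmented_reeb_edges n)\<^sup>*"
    unfolding augmented_reeb_poset_def reeb_vertices_eq_fibres[OF n] by blast
  then show "A \<subseteq> {1..n - 1} \<and> B \<subseteq> {1..n - 1} \<and> \<nu> A \<le> \<nu> B"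
    using reachable_imp_\<nu>_le[OF n] by (simp add: vertex_label_fibre[OF n])
next
  assume *: "A \<subseteq> {1..n - 1} \<and> B \<subseteq> {1..n - 1} \<and> \<nu> A \<le> \<nu> B"
  then have "A = B \<or> binary_less A B"
    using inj_on_\<nu>[of "n - 1"] \<nu>_less_iff_binary_less[of A "n - 1" B]
    by (auto simp: inj_on_def le_less)
  then have "(label_fibre n A, label_fibre n B) \<in> (augmented_reeb_edges n)\<^sup>*"
    using binary_less_reachable[OF n] * by blast
  moreover have "label_fibre n A \<in> reeb_vertices n" "label_fibre n B \<in> reeb_vertices n"
    unfolding reeb_vertices_eq_fibres[OF n] using * by auto
  ultimately have "(vertex_label n (label_fibre n A), vertex_label n (label_fibre n B))
      \<in> augmented_reeb_poset n"
    unfolding augmented_reeb_poset_def by blast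
  then show "(A, B) \<in> augmented_reeb_poset n" using * by (simp add: vertex_label_fibre[OF n])
qed

theorem corollary2p5:
  fixes n :: nat
  assumes "n \<ge> 2"
  shows "(\<forall>w\<in>S n. vertex_label n (sim_h n `` {w}) = right_of_max n w) \<and>
    bij_betw (vertex_label n) (reeb_vertices n) (Pow {1..n - 1}) \<and>
    linear_order_on (Pow {1..n - 1}) (augmented_reeb_poset n) \<and>
    (\<forall>A\<in>Pow {1..n - 1}. \<forall>B\<in>Pow {1..n - 1}.
       (A, B) \<in> augmented_reeb_poset n \<longleftrightarrow> \<nu> A \<le> \<nu> B)"
proof (intro conjI)
  have n: "0 < n" using assms by simp
  show "\<forall>w\<in>S n. vertex_label n (sim_h n `` {w}) = right_of_max n w"
    using sim_h_class_eq_fibre[OF n] vertex_label_fibre[OF n right_of_max_subset] by metis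
  show "bij_betw (vertex_label n) (reeb_vertices n) (Pow {1..n - 1})"
    unfolding reeb_vertices_eq_fibres[OF n]
    by (rule bij_betw_byWitness[where f' = "label_fibre n"])
      (auto simp: vertex_label_fibre[OF n] simp del: atLeastAtMost_iff)
  show "linear_order_on (Pow {1..n - 1}) (augmented_reeb_poset n)"
    unfolding linear_order_on_def partial_order_on_def preorder_on_def
  proof (intro conjI)
    show "antisym (augmented_reeb_poset n)"
      using inj_on_\<nu>[of "n - 1"]
      by (auto simp: antisym_def augmented_reeb_poset_iff[OF n] inj_on_def simp del: atLeastAtMost_iff)
    show "trans (augmented_reeb_poset n)"
      by (rule transI) (auto simp: augmented_reeb_poset_iff[OF n])
  qed (auto simp: augmented_reeb_poset_iff[OF n] refl_on_def total_on_def simp del: atLeastAtMost_iff)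
  show "\<forall>A\<in>Pow {1..n - 1}. \<forall>B\<in>Pow {1..n - 1}.
       (A, B) \<in> augmented_reeb_poset n \<longleftrightarrow> \<nu> A \<le> \<nu> B"
    by (simp add: augmented_reeb_poset_iff[OF n])
qed

end
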